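(* The $\mathsf{MISL}$-formula $$\varphi:=\langle p:=\Box\bot;(p:=p\lor\Box\Diamond p)^*\rangle(\Diamond p\land\Diamond(\neg p\land\Box\Diamond p))$$ is not definable by $\mu\mathsf{ML}$, where $\mu\mathsf{ML}$ is understood as the fragment of the modal $\mu$-calculus in which the fixed point of every formula can be reached by a finite sequence of approximation. That is, there is no formula $\varphi_\mu$ of this fragment such that for every model $M$ and state $s$ of $M$, $M,s\vDash_{\mathsf{MISL}}\varphi$ if and only if $M,s\vDash_{\mu\mathsf{ML}}\varphi_\mu$.
   Context: $\mathcal{L}_{\mathsf{MISL}}$: $\varphi::=p\mid\neg\varphi\mid\varphi\land\varphi\mid\Diamond\varphi\mid\langle p:=\varphi\rangle\varphi\mid\langle(p:=\varphi)^*\rangle\varphi$, with $p$ from a countable set $\mathbf{P}$ of propositional letters; $\top,\bot,\lor$ and $\Box=\neg\Diamond\neg$ are the usual abbreviations, and $\langle\alpha;\beta\rangle\varphi$ abbreviates $\langle\alpha\rangle\langle\beta\rangle\varphi$. A model is $M=(W,R,V)$ with $W\ne\emptyset$, $R\subseteq W\times W$, $V:\mathbf{P}\to2^W$. Truth: letters, Booleans and $\Diamond$ (along $R$) as usual; $M,w\vDash\langle p:=\psi\rangle\varphi$ iff $M|_{p:=\psi},w\vDash\varphi$, where $M|_{p:=\psi}$ is $M$ with the value of $p$ changed to $\{v\in W:M,v\vDash\psi\}$; $M,w\vDash\langle(p:=\psi)^*\rangle\varphi$ iff $M|_{(p:=\psi)^n},w\vDash\varphi$ for some $n\in\mathbb{N}$,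 where $M|_{(p:=\psi)^0}=M$ and $M|_{(p:=\psi)^{n+1}}=(M|_{(p:=\psi)^n})|_{p:=\psi}$. The modal $\mu$-calculus is basic modal logic extended with least fixed-point formulas $\mu p.\chi$ ($p$ occurring only positively in $\chi$), interpreted on the same models; the truth set of $\mu p.\chi$ in $(W,R,V)$ is the least fixed point of the map $F(X)=\{w\in W:(W,R,V[p\mapsto X]),w\vDash\chi\}$. In general this fixed point is reached by an ordinal sequence of approximations starting from $\emptyset$. Throughout, $\mu\mathsf{ML}$ denotes only the fragment in which the fixed point of every formula can be reached by a finite sequence of approximation, i.e. it is obtained as $X_n$ for some $n\in\mathbb{N}$, where $X_0=\emptyset$ and $X_{n+1}=F(X_n)$. *)

theory Defs
  imports Main "HOL-Library.Countable"
begin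

record ('w, 'p) model =
  worlds :: "'w set"
  acc :: "('w \<times> 'w) set"
  valu :: "'p \<Rightarrow> 'w set"

definition is_model :: "('w, 'p) model \<Rightarrow> bool" where
  "is_model M \<longleftrightarrow> worlds M \<noteq> {} \<and> acc M \<subseteq> worlds M \<times> worlds M \<and> (\<forall>p. valu M p \<subseteq> worlds M)"

definition set_letter :: "('w, 'p) model \<Rightarrow> 'p \<Rightarrow> 'w set \<Rightarrow> ('w, 'p) model" where
  "set_letter M p X = M\<lparr>valu := (valu M)(p := X)\<rparr>"


datatype 'p misl =
    Ltr 'p
  | Neg "'p misl"
  | Conj "'p misl" "'p misl"
  | Dia "'p misl"
  | Asg 'p "'p misl" "'p misl"  \<comment> \<open>\<open>Asg p \<psi> \<phi>\<close> is \<open>\<langle>p := \<psi>\<rangle>\<phi>\<close>\<close>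
  | AsgStar 'p "'p misl" "'p misl"  \<comment> \<open>\<open>AsgStar p \<psi> \<phi>\<close> is \<open>\<langle>(p := \<psi>)\<^sup>*\<rangle>\<phi>\<close>\<close>

primrec misl_sat :: "('w, 'p) model \<Rightarrow> 'w \<Rightarrow> 'p misl \<Rightarrow> bool" where
  "misl_sat M w (Ltr q) \<longleftrightarrow> w \<in> valu M q"
| "misl_sat M w (Neg \<phi>) \<longleftrightarrow> \<not> misl_sat M w \<phi>"
| "misl_sat M w (Conj \<phi> \<psi>) \<longleftrightarrow> misl_sat M w \<phi> \<and> misl_sat M w \<psi>"
| "misl_sat M w (Dia \<phi>) \<longleftrightarrow> (\<exists>v. (w, v) \<in> acc M \<and> misl_sat M v \<phi>)"
| "misl_sat M w (Asg p \<psi> \<phi>) \<longleftrightarrow>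
     misl_sat (set_letter M p {v \<in> worlds M. misl_sat M v \<psi>}) w \<phi>"
| "misl_sat M w (AsgStar p \<psi> \<phi>) \<longleftrightarrow>
     (\<exists>n. misl_sat (((\<lambda>N. set_letter N p {v \<in> worlds N. misl_sat N v \<psi>}) ^^ n) M) w \<phi>)"

definition Disj :: "'p misl \<Rightarrow> 'p misl \<Rightarrow> 'p misl" where
  "Disj \<phi> \<psi> = Neg (Conj (Neg \<phi>) (Neg \<psi>))"

definition Box :: "'p misl \<Rightarrow> 'p misl" where
  "Box \<phi> = Neg (Dia (Neg \<phi>))"

text \<open>The language has no propositional constant, so \<open>\<bottom>\<close> is a contradiction over
  some letter; the choice of the letter is irrelevant.\<close>

definition Bot :: "'p \<Rightarrow> 'p misl" where
  "Bot q = Conj (Ltr q) (Neg (Ltr q))"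

text \<open>\<open>\<langle>p := \<box>\<bottom>; (p := p \<or> \<box>\<diamond>p)\<^sup>*\<rangle>(\<diamond>p \<and> \<diamond>(\<not>p \<and> \<box>\<diamond>p))\<close>,
  with \<open>\<langle>\<alpha>; \<beta>\<rangle>\<close> expanded to \<open>\<langle>\<alpha>\<rangle>\<langle>\<beta>\<rangle>\<close>.\<close>

definition misl_phi :: "'p \<Rightarrow> 'p misl" where
  "misl_phi p =
     Asg p (Box (Bot p))
       (AsgStar p (Disj (Ltr p) (Box (Dia (Ltr p))))
         (Conj (Dia (Ltr p)) (Dia (Conj (Neg (Ltr p)) (Box (Dia (Ltr p)))))))"


datatype 'p mu_fm =
    MLtr 'p
  | MNeg "'p mu_fm"
  | MConj "'p mu_fm" "'p mu_fm"
  | MDia "'p mu_fm"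
  | Mu 'p "'p mu_fm"

text \<open>\<open>only_pol True p \<phi>\<close>: every free occurrence of \<open>p\<close> in \<open>\<phi>\<close> is positive (under an even
  number of negations); \<open>only_pol False p \<phi>\<close>: every free occurrence is negative.\<close>

primrec only_pol :: "bool \<Rightarrow> 'p \<Rightarrow> 'p mu_fm \<Rightarrow> bool" where
  "only_pol b p (MLtr q) \<longleftrightarrow> (q = p \<longrightarrow> b)"
| "only_pol b p (MNeg \<phi>) \<longleftrightarrow> only_pol (\<not> b) p \<phi>"
| "only_pol b p (MConj \<phi> \<psi>) \<longleftrightarrow> only_pol b p \<phi> \<and> only_pol b p \<psi>"
| "only_pol b p (MDia \<phi>) \<longleftrightarrow> only_pol b p \<phi>"
| "only_pol b p (Mu q \<phi>) \<longleftrightarrow> (q = p \<or> only_pol b p \<phi>)"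

primrec mu_subfms :: "'p mu_fm \<Rightarrow> 'p mu_fm set" where
  "mu_subfms (MLtr q) = {MLtr q}"
| "mu_subfms (MNeg \<phi>) = insert (MNeg \<phi>) (mu_subfms \<phi>)"
| "mu_subfms (MConj \<phi> \<psi>) = insert (MConj \<phi> \<psi>) (mu_subfms \<phi> \<union> mu_subfms \<psi>)"
| "mu_subfms (MDia \<phi>) = insert (MDia \<phi>) (mu_subfms \<phi>)"
| "mu_subfms (Mu q \<phi>) = insert (Mu q \<phi>) (mu_subfms \<phi>)"

definition mu_wf :: "'p mu_fm \<Rightarrow> bool" where
  "mu_wf \<phi> \<longleftrightarrow> (\<forall>p \<chi>. Mu p \<chi> \<in> mu_subfms \<phi> \<longrightarrow> only_pol True p \<chi>)"

primrec mu_sat :: "('w, 'p) model \<Rightarrow> 'w \<Rightarrow> 'p mu_fm \<Rightarrow> bool" where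
  "mu_sat M w (MLtr q) \<longleftrightarrow> w \<in> valu M q"
| "mu_sat M w (MNeg \<phi>) \<longleftrightarrow> \<not> mu_sat M w \<phi>"
| "mu_sat M w (MConj \<phi> \<psi>) \<longleftrightarrow> mu_sat M w \<phi> \<and> mu_sat M w \<psi>"
| "mu_sat M w (MDia \<phi>) \<longleftrightarrow> (\<exists>v. (w, v) \<in> acc M \<and> mu_sat M v \<phi>)"
| "mu_sat M w (Mu p \<chi>) \<longleftrightarrow>
     w \<in> lfp (\<lambda>X. {v \<in> worlds M. mu_sat (set_letter M p X) v \<chi>})"

definition mu_op :: "('w, 'p) model \<Rightarrow> 'p \<Rightarrow> 'p mu_fm \<Rightarrow> 'w set \<Rightarrow> 'w set" where
  "mu_op M p \<chi> X = {w \<in> worlds M. mu_sat (set_letter M p X) w \<chi>}"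

lemma mu_sat_Mu: "mu_sat M w (Mu p \<chi>) \<longleftrightarrow> w \<in> lfp (mu_op M p \<chi>)"
  by (simp add: mu_op_def[abs_def])

text \<open>The fragment in which every fixed point is reached after finitely many approximation
  steps. This is required of every fixed-point subformula in every model; the number of steps
  may depend on the model. HOL cannot quantify over all carrier types inside a formula, so the
  type from which the carriers of the models are taken is an explicit parameter.\<close>

definition in_muML :: "'w itself \<Rightarrow> 'p mu_fm \<Rightarrow> bool" where
  "in_muML _ \<phi> \<longleftrightarrow> mu_wf \<phi> \<and>
     (\<forall>p \<chi>. Mu p \<chi> \<in> mu_subfms \<phi> \<longrightarrow>
       (\<forall>M :: ('w, 'p) model. is_model M \<longrightarrow>
         (\<exists>n. lfp (mu_op M p \<chi>) = (mu_op M p \<chi> ^^ n) {})))"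

end

theory Submission
  imports Defs
begin

text \<open>Call a position of a graph lost in \<open>0\<close> rounds if it has no successor, and lost in
  \<open>n + 1\<close> rounds if every move from it can be answered by a move to a position lost in at most
  \<open>n\<close> rounds. After the assignment and \<open>n\<close> further iterations \<open>p\<close> holds at the positions lost
  in at most \<open>n\<close> rounds, so the formula says that two successors of the current state are lost
  in different finite numbers of rounds. The star makes this expressible: it stops the
  iteration at a well-chosen moment and then inspects the stage reached.

  A fixed point that is reached after finitely many steps cannot produce anything new of this
  kind. On one fixed model its approximations are obtained from \<open>\<emptyset>\<close> by finitely many
  evaluations of the body, so a family of sets of worlds that contains the values of the
  letters and is closed under the Boolean and modal operations also contains the truth set of
  every formula of the fragment (lemma \<open>muML_truth_set_in_modal_algebra\<close>). The number of steps
  may depend on the model; this is harmless, as the argument never leaves the chosen model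
  except for changing the values of letters within the family.

  It remains to exhibit one frame and one such family that does not contain the truth set of
  the formula. The frame is an infinite descending chain, in which exactly the even points
  \<open>2n\<close> are lost, in \<open>n\<close> rounds, together with states \<open>S n\<close> that see only \<open>2n\<close> and
  states \<open>T n\<close> that see \<open>2n\<close> and \<open>2n + 2\<close>. The formula holds at every \<open>T n\<close> and at no \<open>S n\<close>.
  The family consists of the sets that are eventually constant along the chain and that
  eventually do not separate \<open>S n\<close> from \<open>T n\<close>.\<close>

section \<open>Finitely reached fixed points stay in a modal algebra\<close>

lemma in_muML_subformula:
  assumes "in_muML TYPE('w) \<phi>" and "mu_subfms \<psi> \<subseteq> mu_subfms \<phi>"
  shows "in_muML TYPE('w) \<psi>"
  using assms unfolding in_muML_def mu_wf_def by blast

lemma mu_fm_in_subfms: "\<phi> \<in> mu_subfms \<phi>"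
  by (cases \<phi>) auto

text \<open>The family \<open>\<A>\<close> is a modal algebra of sets, that is, the admissible sets of a general
  frame. The induction has to vary the valuation, since the body of a fixed-point formula is
  evaluated with its letter set to an approximation; these approximations are themselves in
  \<open>\<A>\<close>, by an inner induction on the stage.\<close>

lemma muML_truth_set_in_modal_algebra:
  fixes M :: "('w, 'p) model"
  assumes sub: "\<And>X. X \<in> \<A> \<Longrightarrow> X \<subseteq> W"
    and empty: "{} \<in> \<A>"
    and compl: "\<And>X. X \<in> \<A> \<Longrightarrow> W - X \<in> \<A>"
    and inter: "\<And>X Y. X \<in> \<A> \<Longrightarrow> Y \<in> \<A> \<Longrightarrow> X \<inter> Y \<in> \<A>"
    and dia: "\<And>X. X \<in> \<A> \<Longrightarrow> {w \<in> W. \<exists>v. (w, v) \<in> R \<and> v \<in> X} \<in> \<A>"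
  shows "in_muML TYPE('w) \<phi> \<Longrightarrow> is_model M \<Longrightarrow> worlds M = W \<Longrightarrow> acc M = R \<Longrightarrow>
    (\<And>q. valu M q \<in> \<A>) \<Longrightarrow> {w \<in> W. mu_sat M w \<phi>} \<in> \<A>"
proof (induction \<phi> arbitrary: M)
  case (MLtr q)
  have "{w \<in> W. mu_sat M w (MLtr q)} = valu M q"
    using sub[OF MLtr.prems(5)] by auto
  with MLtr.prems(5) show ?case by simp
next
  case (MNeg \<phi>)
  have "in_muML TYPE('w) \<phi>"
    using MNeg.prems(1) by (rule in_muML_subformula) auto
  from compl[OF MNeg.IH[OF this MNeg.prems(2-5)]]
  have "W - {w \<in> W. mu_sat M w \<phi>} \<in> \<A>" .
  also have "W - {w \<in> W. mu_sat M w \<phi>} = {w \<in> W. mu_sat M w (MNeg \<phi>)}" by auto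
  finally show ?case .
next
  case (MConj \<phi> \<psi>)
  have "in_muML TYPE('w) \<phi>" "in_muML TYPE('w) \<psi>"
    using MConj.prems(1) by (auto intro: in_muML_subformula)
  from inter[OF MConj.IH(1)[OF this(1) MConj.prems(2-5)]
      MConj.IH(2)[OF this(2) MConj.prems(2-5)]]
  have "{w \<in> W. mu_sat M w \<phi>} \<inter> {w \<in> W. mu_sat M w \<psi>} \<in> \<A>" .
  also have "{w \<in> W. mu_sat M w \<phi>} \<inter> {w \<in> W. mu_sat M w \<psi>} =
      {w \<in> W. mu_sat M w (MConj \<phi> \<psi>)}" by auto
  finally show ?case .
next
  case (MDia \<phi>)
  have "in_muML TYPE('w) \<phi>"
    using MDia.prems(1) by (rule in_muML_subformula) auto
  from dia[OF MDia.IH[OF this MDia.prems(2-5)]]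
  have "{w \<in> W. \<exists>v. (w, v) \<in> R \<and> v \<in> {w \<in> W. mu_sat M w \<phi>}} \<in> \<A>" .
  also have "{w \<in> W. \<exists>v. (w, v) \<in> R \<and> v \<in> {w \<in> W. mu_sat M w \<phi>}} =
      {w \<in> W. mu_sat M w (MDia \<phi>)}"
    using MDia.prems(2-4) by (auto simp: is_model_def)
  finally show ?case .
next
  case (Mu q \<chi>)
  have \<chi>: "in_muML TYPE('w) \<chi>"
    using Mu.prems(1) by (rule in_muML_subformula) auto
  have step: "mu_op M q \<chi> X \<in> \<A>" if X: "X \<in> \<A>" for X
  proof -
    let ?N = "set_letter M q X"
    have "is_model ?N" "worlds ?N = W" "acc ?N = R" "\<And>r. valu ?N r \<in> \<A>"
      using Mu.prems(2-5) X sub[OF X] by (auto simp: is_model_def set_letter_def)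
    from Mu.IH[OF \<chi> this] show ?thesis
      using Mu.prems(3) by (simp add: mu_op_def)
  qed
  have approx: "(mu_op M q \<chi> ^^ n) {} \<in> \<A>" for n
    by (induction n) (simp_all add: empty step)
  obtain n where n: "lfp (mu_op M q \<chi>) = (mu_op M q \<chi> ^^ n) {}"
    using Mu.prems(1,2) mu_fm_in_subfms[of "Mu q \<chi>"] unfolding in_muML_def by blast
  have "{w \<in> W. mu_sat M w (Mu q \<chi>)} = W \<inter> (mu_op M q \<chi> ^^ n) {}"
    unfolding mu_sat_Mu n by auto
  also have "\<dots> = (mu_op M q \<chi> ^^ n) {}"
    using sub[OF approx] by blast
  finally show ?case using approx by simp
qed

section \<open>The chain with observers\<close>

datatype node = C nat | S nat | T nat

instance node :: countable
  by countable_datatype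

inductive edge :: "node \<Rightarrow> node \<Rightarrow> bool" where
  chain: "edge (C (Suc n)) (C n)"
| single: "edge (S n) (C (2 * n))"
| pair_low: "edge (T n) (C (2 * n))"
| pair_high: "edge (T n) (C (2 * n + 2))"

inductive_simps edge_C: "edge (C n) b"
inductive_simps edge_S: "edge (S n) b"
inductive_simps edge_T: "edge (T n) b"

text \<open>A copy of the frame, along an injection \<open>h\<close>, in an arbitrary carrier type. The letters
  are all false, so that the frame alone has to account for the truth sets.\<close>

definition chain_model :: "(node \<Rightarrow> 'w) \<Rightarrow> ('w, 'p) model" where
  "chain_model h =
     \<lparr>worlds = range h, acc = {(h a, h b) |a b. edge a b}, valu = (\<lambda>_. {})\<rparr>"

lemma worlds_chain_model [simp]: "worlds (chain_model h) = range h"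
  by (simp add: chain_model_def)

lemma is_model_chain_model: "is_model (chain_model h)"
  by (auto simp: chain_model_def is_model_def)

lemma chain_model_acc_iff:
  assumes "inj h"
  shows "(h a, v) \<in> acc (chain_model h) \<longleftrightarrow> (\<exists>b. v = h b \<and> edge a b)"
  using assms by (auto simp: chain_model_def dest: injD)

lemma chain_model_ex_succ:
  "inj h \<Longrightarrow> (\<exists>v. (h a, v) \<in> acc (chain_model h) \<and> P v) \<longleftrightarrow> (\<exists>b. edge a b \<and> P (h b))"
  by (auto simp: chain_model_acc_iff)

lemma chain_model_all_succ:
  "inj h \<Longrightarrow> (\<forall>v. (h a, v) \<in> acc (chain_model h) \<longrightarrow> P v) \<longleftrightarrow> (\<forall>b. edge a b \<longrightarrow> P (h b))"
  by (auto simp: chain_model_acc_iff)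

definition tame :: "(node \<Rightarrow> 'w) \<Rightarrow> 'w set \<Rightarrow> bool" where
  "tame h X \<longleftrightarrow> X \<subseteq> range h \<and>
     (\<exists>d b. \<forall>n\<ge>d. (h (C n) \<in> X \<longleftrightarrow> b) \<and> (h (S n) \<in> X \<longleftrightarrow> h (T n) \<in> X))"

lemma tame_empty: "tame h {}"
  by (auto simp: tame_def)

lemma tame_compl: "tame h X \<Longrightarrow> tame h (range h - X)"
  unfolding tame_def by (metis Diff_iff Diff_subset rangeI)

lemma tame_inter:
  assumes "tame h X" "tame h Y"
  shows "tame h (X \<inter> Y)"
proof -
  obtain d b where X: "X \<subseteq> range h"
    "\<forall>n\<ge>d. (h (C n) \<in> X \<longleftrightarrow> b) \<and> (h (S n) \<in> X \<longleftrightarrow> h (T n) \<in> X)"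
    using assms(1) unfolding tame_def by blast
  obtain e c where Y: "\<forall>n\<ge>e. (h (C n) \<in> Y \<longleftrightarrow> c) \<and> (h (S n) \<in> Y \<longleftrightarrow> h (T n) \<in> Y)"
    using assms(2) unfolding tame_def by blast
  have "\<forall>n\<ge>max d e. (h (C n) \<in> X \<inter> Y \<longleftrightarrow> b \<and> c) \<and>
      (h (S n) \<in> X \<inter> Y \<longleftrightarrow> h (T n) \<in> X \<inter> Y)"
    using X Y by simp
  with X show ?thesis unfolding tame_def by blast
qed

text \<open>Whether \<open>S n\<close> and \<open>T n\<close> see a point of \<open>X\<close> depends only on the chain, and there \<open>X\<close> is
  constant from \<open>d\<close> on; no edge leads back to \<open>S n\<close> or \<open>T n\<close>. The threshold grows by one
  because the point \<open>d\<close> of the chain sees \<open>d - 1\<close>.\<close>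

lemma tame_dia:
  assumes h: "inj h" and X: "tame h X"
  shows "tame h {w \<in> range h. \<exists>v. (w, v) \<in> acc (chain_model h) \<and> v \<in> X}" (is "tame h ?Y")
proof -
  obtain d b where d: "\<And>n. n \<ge> d \<Longrightarrow> h (C n) \<in> X \<longleftrightarrow> b"
    using X unfolding tame_def by blast
  have Y: "h a \<in> ?Y \<longleftrightarrow> (\<exists>c. edge a c \<and> h c \<in> X)" for a
    by (auto simp: chain_model_acc_iff[OF h])
  have "(h (C n) \<in> ?Y \<longleftrightarrow> b) \<and> (h (S n) \<in> ?Y \<longleftrightarrow> h (T n) \<in> ?Y)" if n: "n \<ge> Suc d" for n
  proof -
    obtain m where m: "n = Suc m" "m \<ge> d"
      using Suc_le_D[OF n] n by auto
    have "h (C n) \<in> ?Y \<longleftrightarrow> b"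
      unfolding Y m(1) edge_C using d[OF m(2)] by simp
    moreover have "h (S n) \<in> ?Y \<longleftrightarrow> b"
      unfolding Y edge_S using d[of "2 * n"] that by simp
    moreover have "h (T n) \<in> ?Y \<longleftrightarrow> b"
      unfolding Y edge_T using d[of "2 * n"] d[of "2 * n + 2"] that by auto
    ultimately show ?thesis by blast
  qed
  then show ?thesis unfolding tame_def by blast
qed

lemma muML_truth_set_tame:
  fixes \<phi> :: "'p mu_fm" and h :: "node \<Rightarrow> 'w"
  assumes "inj h" and "in_muML TYPE('w) \<phi>"
  shows "tame h {w \<in> range h. mu_sat (chain_model h) w \<phi>}"
proof -
  have "{w \<in> range h. mu_sat (chain_model h) w \<phi>} \<in> {X. tame h X}"
  proof (rule muML_truth_set_in_modal_algebra[where R = "acc (chain_model h)"])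
    show "X \<subseteq> range h" if "X \<in> {X. tame h X}" for X
      using that by (simp add: tame_def)
  next
    show "worlds (chain_model h) = range h" "valu (chain_model h) q \<in> {X. tame h X}" for q :: 'p
      by (simp_all add: chain_model_def tame_empty)
  qed (use assms in \<open>simp_all add: tame_empty tame_compl tame_inter tame_dia
      is_model_chain_model\<close>)
  then show ?thesis by simp
qed

section \<open>The truth set of the assignment formula\<close>

lemma set_letter_simps [simp]:
  "worlds (set_letter M p X) = worlds M"
  "acc (set_letter M p X) = acc M"
  "valu (set_letter M p X) p = X"
  "set_letter (set_letter M p X) p Y = set_letter M p Y"
  by (simp_all add: set_letter_def)

lemma misl_sat_Disj [simp]: "misl_sat M w (Disj \<phi> \<psi>) \<longleftrightarrow> misl_sat M w \<phi> \<or> misl_sat M w \<psi>"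
  by (simp add: Disj_def)

lemma misl_sat_Box [simp]:
  "misl_sat M w (Box \<phi>) \<longleftrightarrow> (\<forall>v. (w, v) \<in> acc M \<longrightarrow> misl_sat M v \<phi>)"
  by (simp add: Box_def)

lemma misl_sat_Bot [simp]: "\<not> misl_sat M w (Bot q)"
  by (simp add: Bot_def)

text \<open>The successive values of \<open>p\<close> under the assignments of the formula, described without
  reference to the valuation; at stage \<open>n\<close> the positions lost in at most \<open>n\<close> rounds.\<close>

primrec lost :: "('w, 'p) model \<Rightarrow> nat \<Rightarrow> 'w set" where
  "lost M 0 = {w \<in> worlds M. \<forall>v. (w, v) \<notin> acc M}"
| "lost M (Suc n) = {w \<in> worlds M. w \<in> lost M n \<or>
     (\<forall>v. (w, v) \<in> acc M \<longrightarrow> (\<exists>u. (v, u) \<in> acc M \<and> u \<in> lost M n))}"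

lemma misl_sat_misl_phi:
  "misl_sat M w (misl_phi p) \<longleftrightarrow>
     (\<exists>n. (\<exists>v. (w, v) \<in> acc M \<and> v \<in> lost M n) \<and>
       (\<exists>v. (w, v) \<in> acc M \<and> v \<notin> lost M n \<and>
         (\<forall>u. (v, u) \<in> acc M \<longrightarrow> (\<exists>x. (u, x) \<in> acc M \<and> x \<in> lost M n))))"
proof -
  let ?update = "\<lambda>N. set_letter N p
    {v \<in> worlds N. misl_sat N v (Disj (Ltr p) (Box (Dia (Ltr p))))}"
  have "(?update ^^ n) (set_letter M p (lost M 0)) = set_letter M p (lost M n)" for n
    by (induction n) simp_all
  then show ?thesis by (simp add: misl_phi_def)
qed

lemma lost_chain:
  fixes h :: "node \<Rightarrow> 'w"
  assumes h: "inj h"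
  shows "h (C m) \<in> lost (chain_model h :: ('w, 'p) model) n \<longleftrightarrow> even m \<and> m \<le> 2 * n"
proof (induction n arbitrary: m)
  case 0
  let ?M = "chain_model h :: ('w, 'p) model"
  have "h (C m) \<in> lost ?M 0 \<longleftrightarrow> (\<forall>b. \<not> edge (C m) b)"
    by (auto simp: chain_model_acc_iff[OF h])
  then show ?case by (cases m) (auto simp: edge_C)
next
  case (Suc n)
  let ?M = "chain_model h :: ('w, 'p) model"
  have "h (C m) \<in> lost ?M (Suc n) \<longleftrightarrow> (even m \<and> m \<le> 2 * n) \<or>
      (\<forall>b. edge (C m) b \<longrightarrow> (\<exists>c. edge b c \<and> h c \<in> lost ?M n))"
    by (simp add: chain_model_all_succ[OF h] chain_model_ex_succ[OF h] Suc.IH)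
  also have "\<dots> \<longleftrightarrow> even m \<and> m \<le> 2 * Suc n"
  proof (cases m)
    case 0
    then show ?thesis by simp
  next
    case (Suc k)
    show ?thesis
    proof (cases k)
      case 0
      with \<open>m = Suc k\<close> show ?thesis by (auto simp: edge_C)
    next
      case (Suc j)
      with \<open>m = Suc k\<close> show ?thesis by (auto simp: edge_C Suc.IH)
    qed
  qed
  finally show ?case .
qed

text \<open>The only successor of \<open>S n\<close> would have to satisfy both \<open>p\<close> and \<open>\<not> p\<close>.\<close>

lemma misl_phi_false_at_S:
  "inj h \<Longrightarrow> \<not> misl_sat (chain_model h) (h (S n)) (misl_phi p)"
  by (auto simp: misl_sat_misl_phi chain_model_acc_iff edge_S)

lemma misl_phi_true_at_T:
  fixes h :: "node \<Rightarrow> 'w" and p :: 'p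
  assumes h: "inj h"
  shows "misl_sat (chain_model h) (h (T n)) (misl_phi p)"
proof -
  let ?M = "chain_model h :: ('w, 'p) model"
  note acc = chain_model_acc_iff[OF h]
  have "\<exists>v. (h (T n), v) \<in> acc ?M \<and> v \<in> lost ?M n"
    by (intro exI[of _ "h (C (2 * n))"]) (auto simp: acc lost_chain[OF h] edge_T)
  moreover have "(h (T n), h (C (2 * n + 2))) \<in> acc ?M"
    by (auto simp: acc edge_T)
  moreover have "h (C (2 * n + 2)) \<notin> lost ?M n"
    by (simp add: lost_chain[OF h])
  moreover have "\<exists>x. (u, x) \<in> acc ?M \<and> x \<in> lost ?M n"
    if "(h (C (2 * n + 2)), u) \<in> acc ?M" for u
  proof -
    have "u = h (C (Suc (2 * n)))"
      using that by (auto simp: acc edge_C)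
    then have "(u, h (C (2 * n))) \<in> acc ?M"
      by (auto simp: acc edge_C)
    then show ?thesis by (auto simp: lost_chain[OF h])
  qed
  ultimately show ?thesis unfolding misl_sat_misl_phi by blast
qed

section \<open>Undefinability\<close>

theorem theorem5p2:
  fixes p :: "'p :: countable"
  assumes "infinite (UNIV :: 'w set)"
  shows "\<not> (\<exists>\<phi>\<^sub>\<mu> :: 'p mu_fm. in_muML TYPE('w) \<phi>\<^sub>\<mu> \<and>
           (\<forall>(M :: ('w, 'p) model) s. is_model M \<and> s \<in> worlds M \<longrightarrow>
              (misl_sat M s (misl_phi p) \<longleftrightarrow> mu_sat M s \<phi>\<^sub>\<mu>)))"
proof
  assume "\<exists>\<phi>\<^sub>\<mu> :: 'p mu_fm. in_muML TYPE('w) \<phi>\<^sub>\<mu> \<and>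
           (\<forall>(M :: ('w, 'p) model) s. is_model M \<and> s \<in> worlds M \<longrightarrow>
              (misl_sat M s (misl_phi p) \<longleftrightarrow> mu_sat M s \<phi>\<^sub>\<mu>))"
  then obtain \<phi> :: "'p mu_fm" where \<phi>: "in_muML TYPE('w) \<phi>"
    and equiv: "\<And>(M :: ('w, 'p) model) s. is_model M \<Longrightarrow> s \<in> worlds M \<Longrightarrow>
      misl_sat M s (misl_phi p) \<longleftrightarrow> mu_sat M s \<phi>"
    by blast
  obtain f :: "nat \<Rightarrow> 'w" where "inj f"
    using infinite_countable_subset[OF assms] by blast
  then have "inj (\<lambda>a. f (to_nat (a :: node)))"
    by (auto intro!: injI dest: injD)
  then obtain h :: "node \<Rightarrow> 'w" where h: "inj h" by blast
  obtain d where "h (S d) \<in> {w \<in> range h. mu_sat (chain_model h) w \<phi>} \<longleftrightarrow>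
      h (T d) \<in> {w \<in> range h. mu_sat (chain_model h) w \<phi>}"
    using muML_truth_set_tame[OF h \<phi>] unfolding tame_def by blast
  then have "mu_sat (chain_model h) (h (S d)) \<phi> \<longleftrightarrow> mu_sat (chain_model h) (h (T d)) \<phi>"
    by simp
  moreover have "misl_sat (chain_model h) (h a) (misl_phi p) \<longleftrightarrow>
      mu_sat (chain_model h) (h a) \<phi>" for a
    by (rule equiv) (simp_all add: is_model_chain_model)
  ultimately show False
    using misl_phi_false_at_S[OF h, of d p] misl_phi_true_at_T[OF h, of d p] by simp
qed

end
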